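(* Let $X$ be a complex Banach space and let $T\in\mathcal{B}(X)$. If every connected component $G$ of $\rho_{su}(T)$ satisfies $G\cap\rho_p(T)\neq\emptyset$, then $$\sigma_{desc}(T)=\sigma_{desc}(T,\mathcal{B}(X)).$$
   Context: $\mathcal{B}(X)$ is the Banach algebra of all bounded linear operators on $X$. For $T\in\mathcal{B}(X)$, $\sigma_{su}(T)=\{\lambda\in\mathbb{C}: \lambda-T\text{ is not surjective}\}$ is the surjectivity spectrum and $\rho_{su}(T)=\mathbb{C}\setminus\sigma_{su}(T)$; $\sigma_p(T)=\{\lambda\in\mathbb{C}: \lambda-T\text{ is not injective}\}$ is the point spectrum and $\rho_p(T)=\mathbb{C}\setminus\sigma_p(T)$. For a linear operator $S$ on a vector space, with range $R(S)$, the descent is $d(S)=\min\{q\ge 0: R(S^q)=R(S^{q+1})\}$, with $d(S)=\infty$ if no such $q$ exists. The descent spectrum of $T$ as an operator is $\sigma_{desc}(T)=\{\lambda\in\mathbb{C}: d(\lambda-T)=\infty\}$. The descent spectrum of $T$ as an element of the algebra $\mathcal{B}(X)$ is $\sigma_{desc}(T,\mathcal{B}(X))=\{\lambda\in\mathbb{C}: d(L_{T-\lambda})=\infty\}$, where for $A\in\mathcal{B}(X)$ the operator $L_A:\mathcal{B}(X)\to\mathcal{B}(X)$ is left multiplication, $L_A(S)=AS$. *)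

theory Defs
  imports "HOL-Analysis.Analysis"
begin

section \<open>Complex Banach spaces\<close>

text \<open>
  The real vector space structure of the library classes is required to be the restriction of the
  complex one, so norm, topology and completeness are those of the library.
\<close>

class complex_normed_vector = real_normed_vector +
  fixes scaleC :: "complex \<Rightarrow> 'a \<Rightarrow> 'a" (infixr "*\<^sub>C" 75)
  assumes scaleC_add_right: "c *\<^sub>C (x + y) = c *\<^sub>C x + c *\<^sub>C y"
    and scaleC_add_left: "(c + d) *\<^sub>C x = c *\<^sub>C x + d *\<^sub>C x"
    and scaleC_scaleC: "c *\<^sub>C d *\<^sub>C x = (c * d) *\<^sub>C x"
    and scaleC_one: "1 *\<^sub>C x = x"
    and scaleR_scaleC: "r *\<^sub>R x = complex_of_real r *\<^sub>C x"
    and norm_scaleC: "norm (c *\<^sub>C x) = cmod c * norm x"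

class complex_banach = complex_normed_vector + banach

instantiation complex :: complex_banach
begin

definition scaleC_complex :: "complex \<Rightarrow> complex \<Rightarrow> complex"
  where "scaleC_complex c x = c * x"

instance
  by standard (auto simp: scaleC_complex_def algebra_simps norm_mult scaleR_conv_of_real)

end


section \<open>Bounded operators\<close>

definition bounded_ops :: "('a::complex_normed_vector \<Rightarrow> 'a) set"
  where "bounded_ops = {T. bounded_linear T \<and> (\<forall>c x. T (c *\<^sub>C x) = c *\<^sub>C T x)}"

definition left_mult :: "('a \<Rightarrow> 'a) \<Rightarrow> ('a \<Rightarrow> 'a) \<Rightarrow> ('a \<Rightarrow> 'a)"
  where "left_mult A S = A \<circ> S"

lemma scaleC_in_bounded_ops: "(\<lambda>x. c *\<^sub>C x) \<in> bounded_ops"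
proof -
  have "bounded_linear (\<lambda>x::'a. c *\<^sub>C x)"
    by (rule bounded_linear_intro[where K = "cmod c"])
      (auto simp: scaleC_add_right scaleR_scaleC scaleC_scaleC norm_scaleC mult.commute)
  then show ?thesis
    by (auto simp: bounded_ops_def scaleC_scaleC mult.commute)
qed

lemma diff_scaleC_in_bounded_ops:
  assumes "T \<in> bounded_ops"
  shows "(\<lambda>x. T x - c *\<^sub>C x) \<in> bounded_ops"
proof -
  have diff: "d *\<^sub>C (x - y) = d *\<^sub>C x - d *\<^sub>C y" for d and x y :: 'a
    using scaleC_add_right[of d "x - y" y] by (simp add: algebra_simps)
  show ?thesis
    using assms scaleC_in_bounded_ops[of c, where ?'a = 'a]
    by (auto simp: bounded_ops_def diff intro: bounded_linear_sub)
qed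

lemma left_mult_in_bounded_ops:
  "A \<in> bounded_ops \<Longrightarrow> S \<in> bounded_ops \<Longrightarrow> left_mult A S \<in> bounded_ops"
  by (auto simp: bounded_ops_def left_mult_def o_def intro: bounded_linear_compose)


section \<open>Descent and spectra\<close>

text \<open>
  Descent of an operator \<open>S\<close> on a vector space with carrier \<open>V\<close>, where \<open>S\<close> maps \<open>V\<close> into itself;
  the carrier is explicit because the bounded operators do not form a whole type. The infimum of
  the empty set in \<^typ>\<open>enat\<close> is \<open>\<infinity>\<close>.
\<close>

definition descent :: "'v set \<Rightarrow> ('v \<Rightarrow> 'v) \<Rightarrow> enat"
  where "descent V S = Inf {enat q |q. (S ^^ q) ` V = (S ^^ Suc q) ` V}"

definition su_spectrum :: "('a::complex_normed_vector \<Rightarrow> 'a) \<Rightarrow> complex set"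
  where "su_spectrum T = {l. \<not> surj (\<lambda>x. l *\<^sub>C x - T x)}"

definition su_resolvent :: "('a::complex_normed_vector \<Rightarrow> 'a) \<Rightarrow> complex set"
  where "su_resolvent T = - su_spectrum T"

definition point_spectrum :: "('a::complex_normed_vector \<Rightarrow> 'a) \<Rightarrow> complex set"
  where "point_spectrum T = {l. \<not> inj (\<lambda>x. l *\<^sub>C x - T x)}"

definition point_resolvent :: "('a::complex_normed_vector \<Rightarrow> 'a) \<Rightarrow> complex set"
  where "point_resolvent T = - point_spectrum T"

definition desc_spectrum :: "('a::complex_normed_vector \<Rightarrow> 'a) \<Rightarrow> complex set"
  where "desc_spectrum T = {l. descent UNIV (\<lambda>x. l *\<^sub>C x - T x) = \<infinity>}"

definition desc_spectrum_alg :: "('a::complex_normed_vector \<Rightarrow> 'a) \<Rightarrow> complex set"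
  where "desc_spectrum_alg T =
    {l. descent bounded_ops (left_mult (\<lambda>x. T x - l *\<^sub>C x)) = \<infinity>}"

end

theory Submission
  imports Defs
begin

text \<open>
  Surjectivity of \<open>T - \<lambda>\<close> is stable under small changes of \<open>\<lambda>\<close>, and so is injectivity or its failure among
  the surjective ones; hence by connectedness the hypothesis makes every surjective \<open>T - \<lambda>\<close> injective.
  Let \<open>A = T - \<lambda>\<close> satisfy \<open>R(A\<^sup>d) = R(A\<^sup>d\<^sup>+\<^sup>1)\<close>. Then \<open>A - \<mu>\<close> is surjective for small \<open>\<mu> \<noteq> 0\<close>, hence injective,
  and an element of \<open>N(A\<^sup>d\<^sup>+\<^sup>1)\<close> outside \<open>N(A\<^sup>d)\<close> would perturb to a nonzero element of \<open>N(A - \<mu>)\<close>. So the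
  ascent is finite as well, and \<open>A\<^sup>d = A\<^sup>d\<^sup>+\<^sup>1 R\<close> for a bounded \<open>R\<close>, which says that left multiplication by \<open>A\<close>
  has descent at most \<open>d\<close>. Conversely such a factorization gives \<open>R(A\<^sup>d) = R(A\<^sup>d\<^sup>+\<^sup>1)\<close> at once.
\<close>

section \<open>Open mapping\<close>

lemma Baire_closed_cover:
  fixes F :: "nat \<Rightarrow> 'a::complete_space set"
  assumes closed: "\<And>n. closed (F n)" and cover: "(\<Union>n. F n) = UNIV"
  shows "\<exists>n. interior (F n) \<noteq> {}"
proof (rule ccontr)
  assume "\<not> ?thesis"
  moreover have "Met_TC.mcomplete TYPE('a)"
    unfolding Met_TC.mcomplete_def by (auto simp: Cauchy_convergent_iff convergent_def)
  ultimately have "interior (\<Union>(range F)) = {}"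
    using Met_TC.metric_Baire_category_alt[of "range F"] closed by auto
  then show False
    using cover by simp
qed

text \<open>A bounded inclusion \<open>range B \<subseteq> range A\<close> comes with a norm bound: the open mapping theorem is the
  case \<open>B = id\<close>, and no quotient space is needed when \<open>A\<close> is not injective.\<close>

lemma range_inclusion_bound:
  fixes A :: "'a::banach \<Rightarrow> 'c::real_normed_vector" and B :: "'b::banach \<Rightarrow> 'c"
  assumes A: "bounded_linear A" and B: "bounded_linear B" and sub: "range B \<subseteq> range A"
  shows "\<exists>C>0. \<forall>x. \<exists>z. A z = B x \<and> norm z \<le> C * norm x"
proof -
  interpret A: bounded_linear A by fact
  interpret B: bounded_linear B by fact
  \<comment> \<open>Baire is applied in the domain of \<open>B\<close>: the sets \<open>E n\<close>
    grade \<open>x\<close> by the size of some \<open>A\<close>-preimage of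
    \<open>B x\<close>.\<close>
  define E where "E = (\<lambda>n::nat. {x. \<exists>z. A z = B x \<and> norm z \<le> real n})"
  have "x \<in> (\<Union>n. closure (E n))" for x
  proof -
    obtain z where "A z = B x"
      using sub by (metis imageE rangeI subsetD)
    then have "x \<in> E (nat \<lceil>norm z\<rceil>)"
      unfolding E_def by (auto intro!: exI[of _ z] of_nat_ceiling)
    then show ?thesis
      using closure_subset by blast
  qed
  then have "(\<Union>n. closure (E n)) = UNIV"
    by blast
  then obtain n where "interior (closure (E n)) \<noteq> {}"
    using Baire_closed_cover[of "\<lambda>n. closure (E n)"] closed_closure by blast
  then obtain x0 r where r: "r > 0" and ball: "ball x0 r \<subseteq> closure (E n)"
    by (metis equals0I mem_interior)
  \<comment> \<open>Two preimages of norm at most \<open>n\<close>, subtracted and divided by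
    \<open>c = r / (2 * norm x)\<close>, give \<open>4 * n / r * norm x\<close>. The summand 1 keeps
    \<open>K\<close> positive when \<open>n = 0\<close>.\<close>
  define K where "K = 4 * real n / r + 1"
  have K: "K > 0"
    using r by (auto simp: K_def intro: add_nonneg_pos)
  have "\<exists>x' z. norm x' \<le> norm x / 2 \<and> A z = B (x - x') \<and> norm z \<le> K * norm x" for x
  proof (cases "x = 0")
    case True
    then show ?thesis
      by (intro exI[of _ 0]) (auto simp: A.zero B.zero)
  next
    case False
    \<comment> \<open>\<open>c *\<^sub>R x\<close> has norm \<open>r / 2\<close>, so
      \<open>x0 + c *\<^sub>R x\<close> stays in the ball. Two approximation errors of
      \<open>r / 8\<close> then add up to half of \<open>c * norm x\<close>, which is where the
      factor 1/2 comes from.\<close>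
    define c where "c = r / (2 * norm x)"
    have c: "c > 0"
      using False r by (simp add: c_def)
    have cx: "c * norm x = r / 2"
      using False by (simp add: c_def)
    have "x0 + c *\<^sub>R x \<in> closure (E n)" "x0 \<in> closure (E n)"
      using r c cx ball by (auto simp: dist_norm subset_iff)
    moreover have "r / 8 > 0"
      using r by simp
    ultimately obtain u v where u: "u \<in> E n" "dist u (x0 + c *\<^sub>R x) < r / 8"
      and v: "v \<in> E n" "dist v x0 < r / 8"
      unfolding closure_approachable by meson
    obtain y where y: "A y = B u" "norm y \<le> n"
      using u(1) by (auto simp: E_def)
    obtain w where w: "A w = B v" "norm w \<le> n"
      using v(1) by (auto simp: E_def)
    define z where "z = (y - w) /\<^sub>R c"
    define x' where "x' = x - (u - v) /\<^sub>R c"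
    have "c *\<^sub>R x' = (v - x0) - (u - (x0 + c *\<^sub>R x))"
      using c by (simp add: x'_def algebra_simps)
    then have "norm (c *\<^sub>R x') \<le> norm (v - x0) + norm (u - (x0 + c *\<^sub>R x))"
      by (metis norm_triangle_ineq4)
    also have "\<dots> \<le> r / 4"
      using u(2) v(2) by (simp add: dist_norm)
    also have "\<dots> = c * (norm x / 2)"
      using cx by simp
    finally have 1: "norm x' \<le> norm x / 2"
      using c by simp
    have 2: "A z = B (x - x')"
      by (simp add: z_def x'_def A.scaleR A.diff B.scaleR B.diff y w)
    have "norm (y - w) \<le> 2 * real n"
      using norm_triangle_ineq4[of y w] y(2) w(2) by linarith
    then have "norm z \<le> 2 * real n / c"
      using c by (simp add: z_def divide_simps mult.commute)
    also have "2 * real n / c = 4 * real n / r * norm x"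
      by (simp add: c_def)
    also have "\<dots> \<le> K * norm x"
      unfolding K_def by (intro mult_right_mono) auto
    finally show ?thesis
      using 1 2 by blast
  qed
  \<comment> \<open>\<open>g x\<close> is an approximate preimage and \<open>f x\<close> the
    remaining error. Repeating the correction on the error gives the exact preimage as the sum of
    all \<open>g ((f ^^ k) x)\<close>.\<close>
  then obtain f g where f: "\<And>x. norm (f x) \<le> norm x / 2"
    and g: "\<And>x. A (g x) = B (x - f x)" "\<And>x. norm (g x) \<le> K * norm x"
    by metis
  have iter: "norm ((f ^^ k) x) \<le> norm x * (1/2) ^ k" for k x
  proof (induction k)
    case (Suc k)
    then show ?case
      using f[of "(f ^^ k) x"] by simp
  qed simp
  have "\<exists>z. A z = B x \<and> norm z \<le> (2 * K) * norm x" for x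
  proof -
    let ?z = "\<lambda>k. g ((f ^^ k) x)"
    have bound: "norm (?z k) \<le> K * norm x * (1/2) ^ k" for k
    proof -
      have "K * norm ((f ^^ k) x) \<le> K * (norm x * (1/2) ^ k)"
        using iter K by (intro mult_left_mono) auto
      then show ?thesis
        using g(2)[of "(f ^^ k) x"] by (simp add: mult.assoc)
    qed
    have geo: "(\<lambda>k. K * norm x * (1/2) ^ k) sums (K * norm x * 2)"
      using sums_mult[OF geometric_sums[of "1/2::real"], of "K * norm x"] by simp
    have summ: "summable (\<lambda>k. norm (?z k))"
      by (rule summable_comparison_test'[OF sums_summable[OF geo], of 0]) (use bound in auto)
    have "(\<lambda>k. norm x * (1/2) ^ k) \<longlonglongrightarrow> 0"
      by (intro tendsto_mult_right_zero LIMSEQ_realpow_zero) auto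
    then have "(\<lambda>k. (f ^^ k) x) \<longlonglongrightarrow> 0"
      by (rule Lim_null_comparison[rotated]) (simp add: iter)
    then have "(\<lambda>k. B ((f ^^ k) x)) \<longlonglongrightarrow> 0"
      using B.tendsto[of "\<lambda>k. (f ^^ k) x" 0] by (simp add: B.zero)
    from telescope_sums'[OF this] have "(\<lambda>k. A (?z k)) sums B x"
      by (simp add: g(1) B.diff)
    moreover have "(\<lambda>k. A (?z k)) sums A (suminf ?z)"
      by (intro A.sums summable_sums summable_norm_cancel[OF summ])
    ultimately have "A (suminf ?z) = B x"
      by (rule sums_unique2[symmetric])
    moreover have "norm (suminf ?z) \<le> K * norm x * 2"
      using summable_norm[OF summ] suminf_le[OF bound summ sums_summable[OF geo]] sums_unique[OF geo]
      by simp
    ultimately show ?thesis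
      by (intro exI[of _ "suminf ?z"]) simp
  qed
  then show ?thesis
    using K by (intro exI[of _ "2 * K"]) auto
qed


section \<open>Bounded complex-linear operators\<close>

lemma bounded_opsD:
  assumes "T \<in> bounded_ops"
  shows "bounded_linear T" "T (c *\<^sub>C x) = c *\<^sub>C T x"
  using assms by (auto simp: bounded_ops_def)

lemma bounded_linear_scaleC: "bounded_linear (\<lambda>x::'a::complex_normed_vector. c *\<^sub>C x)"
  using scaleC_in_bounded_ops by (rule bounded_opsD)

lemmas scaleC_zero_right = linear_0[OF bounded_linear.linear[OF bounded_linear_scaleC]]

lemma id_in_bounded_ops: "id \<in> bounded_ops"
  by (auto simp: bounded_ops_def id_def)

lemma compose_in_bounded_ops:
  "A \<in> bounded_ops \<Longrightarrow> B \<in> bounded_ops \<Longrightarrow> A \<circ> B \<in> bounded_ops"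
  using left_mult_in_bounded_ops[of A B] by (simp add: left_mult_def)

lemma funpow_in_bounded_ops: "A \<in> bounded_ops \<Longrightarrow> A ^^ n \<in> bounded_ops"
  by (induction n) (auto intro: compose_in_bounded_ops id_in_bounded_ops)

text \<open>The solution is the Neumann series \<open>x = \<Sum>k. \<mu>\<^sup>k z\<^sub>k\<close> with \<open>P z\<^sub>k\<^sub>+\<^sub>1 = Q z\<^sub>k\<close>.\<close>

lemma perturbed_solution:
  fixes P Q :: "'a::complex_banach \<Rightarrow> 'a"
  assumes P: "P \<in> bounded_ops" and Q: "Q \<in> bounded_ops" and sub: "range Q \<subseteq> range P"
  shows "\<exists>C>0. \<forall>\<mu> z. cmod \<mu> * C \<le> 1/2 \<longrightarrow>
    (\<exists>x. P x - \<mu> *\<^sub>C Q x = P z \<and> norm (x - z) \<le> 2 * C * cmod \<mu> * norm z)"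
proof -
  interpret P: bounded_linear P using P by (rule bounded_opsD)
  interpret Q: bounded_linear Q using Q by (rule bounded_opsD)
  obtain C where C: "C > 0" and "\<forall>x. \<exists>z. P z = Q x \<and> norm z \<le> C * norm x"
    using range_inclusion_bound[OF P.bounded_linear_axioms Q.bounded_linear_axioms sub] by blast
  then obtain g where g: "\<And>x. P (g x) = Q x" "\<And>x. norm (g x) \<le> C * norm x"
    by metis
  have "\<exists>x. P x - \<mu> *\<^sub>C Q x = P z \<and> norm (x - z) \<le> 2 * C * cmod \<mu> * norm z"
    if \<mu>: "cmod \<mu> * C \<le> 1/2" for \<mu> z
  proof -
    \<comment> \<open>\<open>g\<close> is only a choice of preimages, not linear; the series needs
      just \<open>P (y (Suc k)) = \<mu> *\<^sub>C Q (y k)\<close> and geometric decay.\<close>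
    define y where "y = (\<lambda>k. \<mu> ^ k *\<^sub>C (g ^^ k) z)"
    have y_Suc: "norm (y (Suc k)) \<le> 1/2 * norm (y k)" for k
    proof -
      have "norm (y (Suc k)) \<le> cmod \<mu> ^ Suc k * (C * norm ((g ^^ k) z))"
        unfolding y_def by (auto simp: norm_scaleC norm_mult norm_power g(2) intro!: mult_left_mono)
      also have "\<dots> = (cmod \<mu> * C) * norm (y k)"
        by (simp add: y_def norm_scaleC norm_power)
      also have "\<dots> \<le> 1/2 * norm (y k)"
        using \<mu> by (intro mult_right_mono) auto
      finally show ?thesis .
    qed
    have y1: "norm (y (Suc 0)) \<le> C * cmod \<mu> * norm z"
      using mult_left_mono[OF g(2)[of z], of "cmod \<mu>"] by (simp add: y_def norm_scaleC mult_ac)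
    \<comment> \<open>The estimate starts at index 1 because \<open>y 0 = z\<close> is subtracted;
      the factor \<open>cmod \<mu>\<close> of the first remaining term makes \<open>x - z\<close>
      small with \<open>\<mu>\<close>.\<close>
    have tail: "norm (y (Suc k)) \<le> C * cmod \<mu> * norm z * (1/2) ^ k" for k
    proof (induction k)
      case (Suc k)
      then show ?case
        using y_Suc[of "Suc k"] by simp
    qed (use y1 in simp)
    have geo: "(\<lambda>k. C * cmod \<mu> * norm z * (1/2) ^ k) sums (C * cmod \<mu> * norm z * 2)"
      using sums_mult[OF geometric_sums[of "1/2::real"], of "C * cmod \<mu> * norm z"] by simp
    have summ: "summable (\<lambda>k. norm (y (Suc k)))"
      by (rule summable_comparison_test'[OF sums_summable[OF geo], of 0]) (use tail in auto)
    then have summ_y: "summable y"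
      by (metis summable_Suc_iff summable_norm_cancel)
    have y_head: "suminf y - z = (\<Sum>k. y (Suc k))"
      using suminf_split_head[OF summ_y] by (simp add: y_def scaleC_one)
    have "norm (suminf y - z) \<le> 2 * C * cmod \<mu> * norm z"
      using summable_norm[OF summ] suminf_le[OF tail summ sums_summable[OF geo]] sums_unique[OF geo]
      by (simp add: y_head mult_ac)
    moreover have "P (suminf y) - \<mu> *\<^sub>C Q (suminf y) = P z"
    proof -
      have step: "P (y (Suc k)) = \<mu> *\<^sub>C Q (y k)" for k
        by (simp add: y_def bounded_opsD(2)[OF P] bounded_opsD(2)[OF Q] g(1) scaleC_scaleC)
      have "P (suminf y) - P z = P (\<Sum>k. y (Suc k))"
        by (simp add: y_head flip: P.diff)
      also have "\<dots> = (\<Sum>k. P (y (Suc k)))"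
        by (rule P.suminf) (simp add: summable_Suc_iff summ_y)
      also have "\<dots> = \<mu> *\<^sub>C Q (suminf y)"
        by (simp add: step bounded_linear.suminf[OF bounded_linear_scaleC]
            Q.suminf[OF summ_y] Q.summable[OF summ_y])
      finally show ?thesis
        by (simp add: algebra_simps)
    qed
    ultimately show ?thesis
      by blast
  qed
  then show ?thesis
    using C by blast
qed


section \<open>Stability of surjectivity and injectivity\<close>

lemma shift_shift:
  "(\<lambda>x. (T x - l *\<^sub>C x) - \<mu> *\<^sub>C x) = (\<lambda>x::'a::complex_normed_vector. T x - (l + \<mu>) *\<^sub>C x)"
  by (auto simp: scaleC_add_left)

lemma inj_bounded_ops_iff:
  assumes "A \<in> bounded_ops"
  shows "inj A \<longleftrightarrow> (\<forall>x. A x = 0 \<longrightarrow> x = 0)"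
  using linear_injective_0 bounded_linear.linear[OF bounded_opsD(1)[OF assms]] by blast

text \<open>Kernel vectors of \<open>A\<close> perturb to nearby kernel vectors of
  \<open>A - \<mu>\<close>, and a surjective injective \<open>A\<close> is bounded below; so both
  injectivity and its failure survive.\<close>

lemma surj_perturbation:
  fixes A :: "'a::complex_banach \<Rightarrow> 'a"
  assumes A: "A \<in> bounded_ops" and surj: "surj A"
  shows "\<exists>e>0. \<forall>\<mu>. cmod \<mu> < e \<longrightarrow>
    surj (\<lambda>x. A x - \<mu> *\<^sub>C x) \<and> (inj (\<lambda>x. A x - \<mu> *\<^sub>C x) \<longleftrightarrow> inj A)"
proof -
  have lin: "bounded_linear A"
    using A by (rule bounded_opsD)
  obtain C where C: "C > 0" and sol: "\<And>\<mu> z. cmod \<mu> * C \<le> 1/2 \<Longrightarrow>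
      \<exists>x. A x - \<mu> *\<^sub>C x = A z \<and> norm (x - z) \<le> 2 * C * cmod \<mu> * norm z"
    using perturbed_solution[OF A id_in_bounded_ops] surj by auto
  obtain D where D: "D > 0" and bound: "\<And>y. \<exists>z. A z = y \<and> norm z \<le> D * norm y"
    using range_inclusion_bound[OF lin bounded_linear_ident] surj by auto
  \<comment> \<open>The first bound admits the perturbed solutions, the second makes
    \<open>cmod \<mu>\<close> smaller than the lower bound \<open>1 / D\<close> of an injective
    \<open>A\<close>.\<close>
  define e where "e = min (1 / (2 * C)) (1 / D)"
  have "surj (\<lambda>x. A x - \<mu> *\<^sub>C x) \<and> (inj (\<lambda>x. A x - \<mu> *\<^sub>C x) \<longleftrightarrow> inj A)" if "cmod \<mu> < e" for \<mu>
  proof -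
    have \<mu>: "cmod \<mu> * C < 1/2" "cmod \<mu> * D < 1"
      using that C D by (auto simp: e_def field_simps)
    note sol' = sol[OF less_imp_le[OF \<mu>(1)]]
    have "surj (\<lambda>x. A x - \<mu> *\<^sub>C x)"
      using sol' surj by (metis surj_def)
    \<comment> \<open>A kernel vector \<open>z\<close> of \<open>A\<close> lies within
      \<open>2 * C * cmod \<mu> * norm z\<close> of a kernel vector of \<open>A - \<mu>\<close>,
      which must be 0. The factor is below 1, hence \<open>z = 0\<close>.\<close>
    moreover have "inj A" if inj: "inj (\<lambda>x. A x - \<mu> *\<^sub>C x)"
      unfolding inj_bounded_ops_iff[OF A]
    proof (intro allI impI)
      fix z assume "A z = 0"
      with sol'[of z] obtain x where x: "A x - \<mu> *\<^sub>C x = 0" "norm (x - z) \<le> 2 * C * cmod \<mu> * norm z"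
        by auto
      then have "x = 0"
        using inj inj_bounded_ops_iff[OF diff_scaleC_in_bounded_ops[OF A]] by blast
      then have "(1 - 2 * C * cmod \<mu>) * norm z \<le> 0"
        using x(2) by (simp add: algebra_simps)
      then show "z = 0"
        using \<mu>(1) by (simp add: mult_le_0_iff mult_ac)
    qed
    moreover have "inj (\<lambda>x. A x - \<mu> *\<^sub>C x)" if inj: "inj A"
      unfolding inj_bounded_ops_iff[OF diff_scaleC_in_bounded_ops[OF A]]
    proof (intro allI impI)
      fix x assume x: "A x - \<mu> *\<^sub>C x = 0"
      obtain z where "A z = A x" "norm z \<le> D * norm (A x)"
        using bound by blast
      then have "norm x \<le> D * norm (A x)"
        using inj by (metis injD)
      then have "norm x \<le> D * norm (\<mu> *\<^sub>C x)"
        using x by simp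
      then have "(1 - cmod \<mu> * D) * norm x \<le> 0"
        by (simp add: norm_scaleC algebra_simps)
      then show "x = 0"
        using \<mu>(2) by (simp add: mult_le_0_iff)
    qed
    ultimately show ?thesis
      by blast
  qed
  moreover have "e > 0"
    using C D by (simp add: e_def)
  ultimately show ?thesis
    by blast
qed

lemma surj_uminus_iff: "surj (\<lambda>x. - f x) \<longleftrightarrow> surj (f :: 'a \<Rightarrow> 'b::group_add)"
  unfolding surj_def by (metis minus_minus)

lemma mem_su_resolvent: "l \<in> su_resolvent T \<longleftrightarrow> surj (\<lambda>x. T x - l *\<^sub>C x)"
  using surj_uminus_iff[of "\<lambda>x. T x - l *\<^sub>C x"] by (simp add: su_resolvent_def su_spectrum_def)

lemma mem_point_resolvent: "l \<in> point_resolvent T \<longleftrightarrow> inj (\<lambda>x. T x - l *\<^sub>C x)"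
proof -
  have "inj (\<lambda>x. l *\<^sub>C x - T x) \<longleftrightarrow> inj (\<lambda>x. T x - l *\<^sub>C x)"
    unfolding inj_def by (metis minus_diff_eq)
  then show ?thesis
    by (simp add: point_resolvent_def point_spectrum_def)
qed

lemma open_su_resolvent_point_resolvent:
  fixes T :: "'a::complex_banach \<Rightarrow> 'a"
  assumes T: "T \<in> bounded_ops"
  shows "open (su_resolvent T \<inter> point_resolvent T)" "open (su_resolvent T - point_resolvent T)"
proof -
  have nbhd: "\<exists>e>0. \<forall>m. dist m l < e \<longrightarrow>
      m \<in> su_resolvent T \<and> (m \<in> point_resolvent T \<longleftrightarrow> l \<in> point_resolvent T)"
    if l: "l \<in> su_resolvent T" for l
  proof -
    obtain e where e: "e > 0" "\<And>\<mu>. cmod \<mu> < e \<Longrightarrow>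
        l + \<mu> \<in> su_resolvent T \<and> (l + \<mu> \<in> point_resolvent T \<longleftrightarrow> l \<in> point_resolvent T)"
      using surj_perturbation[OF diff_scaleC_in_bounded_ops[OF T, of l]] l
      unfolding mem_su_resolvent mem_point_resolvent shift_shift by blast
    have "m \<in> su_resolvent T \<and> (m \<in> point_resolvent T \<longleftrightarrow> l \<in> point_resolvent T)"
      if "dist m l < e" for m
      using e(2)[of "m - l"] that by (simp add: dist_norm)
    then show ?thesis
      using e(1) by blast
  qed
  show "open (su_resolvent T \<inter> point_resolvent T)"
    unfolding open_dist
  proof
    fix l assume "l \<in> su_resolvent T \<inter> point_resolvent T"
    then show "\<exists>e>0. \<forall>m. dist m l < e \<longrightarrow> m \<in> su_resolvent T \<inter> point_resolvent T"
      using nbhd[of l] by auto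
  qed
  show "open (su_resolvent T - point_resolvent T)"
    unfolding open_dist
  proof
    fix l assume "l \<in> su_resolvent T - point_resolvent T"
    then show "\<exists>e>0. \<forall>m. dist m l < e \<longrightarrow> m \<in> su_resolvent T - point_resolvent T"
      using nbhd[of l] by auto
  qed
qed

text \<open>The injective and the non-injective points of the surjectivity resolvent form two
  disjoint open sets, so a component that meets the first lies in it.\<close>

lemma su_resolvent_subset_point_resolvent:
  fixes T :: "'a::complex_banach \<Rightarrow> 'a"
  assumes T: "T \<in> bounded_ops"
    and meets: "\<And>G. G \<in> components (su_resolvent T) \<Longrightarrow> G \<inter> point_resolvent T \<noteq> {}"
  shows "su_resolvent T \<subseteq> point_resolvent T"
proof
  fix l assume l: "l \<in> su_resolvent T"
  define G where "G = connected_component_set (su_resolvent T) l"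
  have G: "G \<in> components (su_resolvent T)"
    using l by (simp add: G_def componentsI)
  have sub: "G \<subseteq> su_resolvent T"
    using G by (rule in_components_subset)
  have "su_resolvent T \<inter> point_resolvent T \<inter> G = {} \<or> (su_resolvent T - point_resolvent T) \<inter> G = {}"
    by (rule connectedD[OF in_components_connected[OF G] open_su_resolvent_point_resolvent[OF T]])
      (use sub in auto)
  moreover have "su_resolvent T \<inter> point_resolvent T \<inter> G \<noteq> {}"
    using meets[OF G] sub by blast
  moreover have "l \<in> G"
    using l by (simp add: G_def)
  ultimately show "l \<in> point_resolvent T"
    using l by blast
qed


section \<open>Finite descent\<close>

lemma funpow_shift_commute:
  assumes "A \<in> bounded_ops"
  shows "(A ^^ n) (A x - \<mu> *\<^sub>C x) = A ((A ^^ n) x) - \<mu> *\<^sub>C (A ^^ n) x"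
  using funpow_in_bounded_ops[OF assms, of n]
  by (simp add: bounded_opsD linear_diff[OF bounded_linear.linear] funpow_swap1)

text \<open>On the kernel of \<open>A ^^ n\<close> the operator \<open>A\<close> is nilpotent, so
  \<open>A - \<mu>\<close> is invertible there.\<close>

lemma kernel_funpow_subset_range_shift:
  assumes A: "A \<in> bounded_ops" and "\<mu> \<noteq> 0" and "(A ^^ n) y = 0"
  shows "y \<in> range (\<lambda>x. A x - \<mu> *\<^sub>C x)"
  using assms(3)
proof (induction n arbitrary: y)
  case 0
  then show ?case
    using linear_0[OF bounded_linear.linear[OF bounded_opsD(1)[OF A]]]
    by (intro range_eqI[of _ _ 0]) (simp add: scaleC_zero_right)
next
  case (Suc n)
  have lin: "linear A"
    using A by (intro bounded_linear.linear bounded_opsD)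
  have "(A ^^ n) (A y) = 0"
    using Suc.prems by (simp add: funpow_swap1)
  then obtain m where m: "A y = A m - \<mu> *\<^sub>C m"
    using Suc.IH by blast
  \<comment> \<open>The equation for \<open>A y\<close> says
    \<open>A (m - y) = \<mu> *\<^sub>C m\<close>; dividing by \<open>\<mu>\<close> and subtracting
    \<open>m - y\<close> leaves \<open>y\<close>.\<close>
  have "y = A (inverse \<mu> *\<^sub>C (m - y)) - \<mu> *\<^sub>C inverse \<mu> *\<^sub>C (m - y)"
  proof -
    have "A m - A y = \<mu> *\<^sub>C m"
      using m by simp
    then show ?thesis
      using \<open>\<mu> \<noteq> 0\<close>
      by (simp add: bounded_opsD(2)[OF A] linear_diff[OF lin] scaleC_scaleC scaleC_one)
  qed
  then show ?case
    by (rule range_eqI)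
qed

text \<open>For small \<open>\<mu>\<close>, \<open>z\<close> perturbs to some \<open>x\<close> with
  \<open>(A - \<mu>) (A ^^ d) x = 0\<close>. Since \<open>A - \<mu>\<close> is surjective and thus
  injective, \<open>(A ^^ d) x = 0\<close>, and \<open>x\<close> tends to \<open>z\<close> as
  \<open>\<mu>\<close> tends to 0.\<close>

lemma finite_descent_imp_kernel_stable:
  fixes A :: "'a::complex_banach \<Rightarrow> 'a"
  assumes A: "A \<in> bounded_ops" and range: "range (A ^^ d) \<subseteq> range (A ^^ Suc d)"
    and inj: "\<And>\<mu>. surj (\<lambda>x. A x - \<mu> *\<^sub>C x) \<Longrightarrow> inj (\<lambda>x. A x - \<mu> *\<^sub>C x)"
    and z: "(A ^^ Suc d) z = 0"
  shows "(A ^^ d) z = 0"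
proof -
  let ?Q = "A ^^ d"
  have Q: "?Q \<in> bounded_ops"
    using A by (rule funpow_in_bounded_ops)
  have Q_lin: "bounded_linear ?Q"
    using Q by (rule bounded_opsD)
  have Q_diff: "?Q (x - y) = ?Q x - ?Q y" for x y
    using Q_lin by (intro linear_diff bounded_linear.linear)
  \<comment> \<open>The pair \<open>A ^^ Suc d\<close>, \<open>A ^^ d\<close> is used, since
    \<open>A ^^ Suc d - \<mu> A ^^ d\<close> is \<open>A ^^ d\<close> composed with
    \<open>A - \<mu>\<close>.\<close>
  obtain C where C: "C > 0" and sol: "\<And>\<mu> z. cmod \<mu> * C \<le> 1/2 \<Longrightarrow>
      \<exists>x. ?Q (A x - \<mu> *\<^sub>C x) = A (?Q z) \<and> norm (x - z) \<le> 2 * C * cmod \<mu> * norm z"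
    using perturbed_solution[OF funpow_in_bounded_ops[OF A, of "Suc d"] Q range]
    by (auto simp: funpow_shift_commute[OF A])
  \<comment> \<open>The equation is first solved modulo the kernel of \<open>A ^^ d\<close>; that
    kernel lies in the range of \<open>A - \<mu>\<close>, which removes the error.\<close>
  have surj: "surj (\<lambda>x. A x - \<mu> *\<^sub>C x)" if \<mu>: "\<mu> \<noteq> 0" "cmod \<mu> * C \<le> 1/2" for \<mu>
    unfolding surj_def
  proof
    fix y
    obtain w where "?Q y = A (?Q w)"
      using range by auto
    with sol[OF \<mu>(2), of w] obtain x where "?Q (A x - \<mu> *\<^sub>C x) = ?Q y"
      by auto
    then have "?Q (y - (A x - \<mu> *\<^sub>C x)) = 0"
      using Q_diff[of y "A x - \<mu> *\<^sub>C x"] by simp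
    from kernel_funpow_subset_range_shift[OF A \<mu>(1) this]
    obtain m where m: "y - (A x - \<mu> *\<^sub>C x) = A m - \<mu> *\<^sub>C m"
      by blast
    have "linear (\<lambda>x. A x - \<mu> *\<^sub>C x)"
      using diff_scaleC_in_bounded_ops[OF A] by (intro bounded_linear.linear bounded_opsD)
    from linear_add[OF this, of m x] have "y = A (m + x) - \<mu> *\<^sub>C (m + x)"
      unfolding m[symmetric] by simp
    then show "\<exists>x. y = A x - \<mu> *\<^sub>C x" ..
  qed
  obtain K where K: "K > 0" "\<And>x. norm (?Q x) \<le> norm x * K"
    using bounded_linear.pos_bounded[OF Q_lin] by blast
  have bound: "norm (?Q z) \<le> 2 * C * norm z * K * t" if t: "0 < t" "t * C \<le> 1/2" for t
  proof -
    let ?\<mu> = "complex_of_real t"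
    have \<mu>: "?\<mu> \<noteq> 0" "cmod ?\<mu> * C \<le> 1/2"
      using t by auto
    obtain x where x: "?Q (A x - ?\<mu> *\<^sub>C x) = 0" "norm (x - z) \<le> 2 * C * t * norm z"
      using sol[OF \<mu>(2), of z] z t by auto
    have "?Q x = 0"
      using x(1) inj[OF surj[OF \<mu>]] inj_bounded_ops_iff[OF diff_scaleC_in_bounded_ops[OF A]]
      unfolding funpow_shift_commute[OF A] by blast
    then have "norm (?Q z) = norm (?Q (x - z))"
      by (simp add: Q_diff)
    also have "\<dots> \<le> norm (x - z) * K"
      by (rule K)
    also have "\<dots> \<le> 2 * C * t * norm z * K"
      using x(2) K(1) by (intro mult_right_mono) auto
    finally show ?thesis
      by (simp add: mult_ac)
  qed
  \<comment> \<open>Letting \<open>t\<close> tend to 0 from the right in \<open>bound\<close> leaves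
    \<open>norm (?Q z) \<le> 0\<close>.\<close>
  have "((\<lambda>t. 2 * C * norm z * K * t) \<longlongrightarrow> 2 * C * norm z * K * 0) (at_right 0)"
    by (intro tendsto_intros)
  moreover have "\<forall>\<^sub>F t in at_right 0. norm (?Q z) \<le> 2 * C * norm z * K * t"
  proof -
    have "\<forall>\<^sub>F t in at_right 0. t \<in> {0<..<1 / (2 * C)}"
      using C by (intro eventually_at_right_real) simp
    then show ?thesis
      by eventually_elim (rule bound, use C in \<open>auto simp: field_simps\<close>)
  qed
  ultimately have "norm (?Q z) \<le> 0"
    using tendsto_lowerbound[of _ _ "at_right (0::real)"] by fastforce
  then show ?thesis
    by simp
qed

text \<open>Here \<open>X = R(A\<^sup>d) \<oplus> N(A\<^sup>d)\<close>, and the factor \<open>R\<close> is the inverse of \<open>A\<close> on \<open>R(A\<^sup>d)\<close>, composed with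
  the projection along \<open>N(A\<^sup>d)\<close>.\<close>

lemma finite_descent_imp_factor:
  fixes A :: "'a::complex_banach \<Rightarrow> 'a"
  assumes A: "A \<in> bounded_ops" and range: "range (A ^^ d) \<subseteq> range (A ^^ Suc d)"
    and inj: "\<And>\<mu>. surj (\<lambda>x. A x - \<mu> *\<^sub>C x) \<Longrightarrow> inj (\<lambda>x. A x - \<mu> *\<^sub>C x)"
  shows "\<exists>R \<in> bounded_ops. A ^^ d = A ^^ Suc d \<circ> R"
proof -
  \<comment> \<open>The exponent \<open>2 * d + 1\<close> of \<open>?P\<close> is chosen so that a
    solution of \<open>?P (g x) = ?Q x\<close> yields \<open>R x = ?Q (g x)\<close> in the range of
    \<open>A ^^ d\<close> with \<open>(A ^^ Suc d) (R x) = ?Q x\<close>.\<close>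
  let ?Q = "A ^^ d" and ?P = "A ^^ (Suc d + d)"
  have ops: "A ^^ n \<in> bounded_ops" for n
    using A by (rule funpow_in_bounded_ops)
  interpret Q: bounded_linear ?Q using ops by (rule bounded_opsD)
  interpret P: bounded_linear ?P using ops by (rule bounded_opsD)
  have range_n: "range ?Q \<subseteq> range (A ^^ (n + d))" for n
  proof (induction n)
    case (Suc n)
    have "range (A ^^ (n + d)) = (A ^^ n) ` range ?Q"
      by (simp add: funpow_add image_comp)
    also have "\<dots> \<subseteq> (A ^^ n) ` range (A ^^ Suc d)"
      using range by (rule image_mono)
    also have "\<dots> = range (A ^^ (n + Suc d))"
      by (simp only: funpow_add[of n "Suc d"] image_comp)
    finally show ?case
      using Suc by simp
  qed simp
  have kernel: "?Q z = 0" if "(A ^^ (n + d)) z = 0" for n z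
    using that
  proof (induction n arbitrary: z)
    case (Suc n)
    have split: "(A ^^ (Suc n + d)) z = (A ^^ Suc d) ((A ^^ n) z)"
      by (metis add.commute add_Suc_shift funpow_add o_apply)
    have "?Q ((A ^^ n) z) = 0"
      by (rule finite_descent_imp_kernel_stable[OF A range inj]) (use Suc.prems split in auto)
    then have "(A ^^ (n + d)) z = 0"
      by (metis add.commute funpow_add o_apply)
    then show ?case
      by (rule Suc.IH)
  qed simp
  obtain C where "C > 0" and "\<forall>x. \<exists>z. ?P z = ?Q x \<and> norm z \<le> C * norm x"
    using range_inclusion_bound[OF P.bounded_linear_axioms Q.bounded_linear_axioms range_n[of "Suc d"]]
    by blast
  then obtain g where g: "\<And>x. ?P (g x) = ?Q x" "\<And>x. norm (g x) \<le> C * norm x"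
    by metis
  define R where "R = ?Q \<circ> g"
  \<comment> \<open>The value of \<open>R\<close> does not depend on the chosen preimage, as the
    kernel of \<open>?P\<close> lies in that of \<open>?Q\<close>. This makes \<open>R\<close>
    linear although \<open>g\<close> need not be.\<close>
  have R_eqI: "R x = ?Q w" if "?P w = ?Q x" for x w
  proof -
    have "?P (g x - w) = 0"
      using that by (simp only: P.diff g) simp
    from kernel[OF this] show ?thesis
      by (simp add: R_def Q.diff)
  qed
  obtain K where K: "K > 0" "\<And>x. norm (?Q x) \<le> norm x * K"
    using Q.pos_bounded by blast
  have scale: "R (c *\<^sub>C x) = c *\<^sub>C R x" for c x
    using R_eqI[of "c *\<^sub>C g x" "c *\<^sub>C x"] by (simp only: bounded_opsD(2)[OF ops] g) (simp add: R_def)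
  have "bounded_linear R"
  proof (rule bounded_linear_intro)
    show "R (x + y) = R x + R y" for x y
      using R_eqI[of "g x + g y" "x + y"] by (simp only: P.add Q.add g) (simp add: R_def)
    show "R (r *\<^sub>R x) = r *\<^sub>R R x" for r x
      by (simp add: scaleR_scaleC scale)
    show "norm (R x) \<le> norm x * (C * K)" for x
    proof -
      have "norm (R x) \<le> norm (g x) * K"
        by (simp add: R_def K)
      also have "\<dots> \<le> C * norm x * K"
        using g(2) K(1) by (intro mult_right_mono) auto
      finally show ?thesis
        by (simp add: mult_ac)
    qed
  qed
  then have "R \<in> bounded_ops"
    by (simp add: bounded_ops_def scale)
  moreover have "?Q = A ^^ Suc d \<circ> R"
    using g(1) by (simp only: R_def funpow_add[of "Suc d" d] o_apply fun_eq_iff) simp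
  ultimately show ?thesis
    by blast
qed


section \<open>The two descent spectra\<close>

lemma descent_eq_infinity_iff:
  "descent V S = \<infinity> \<longleftrightarrow> (\<forall>q. (S ^^ q) ` V \<noteq> (S ^^ Suc q) ` V)"
proof
  assume inf: "descent V S = \<infinity>"
  show "\<forall>q. (S ^^ q) ` V \<noteq> (S ^^ Suc q) ` V"
  proof (intro allI notI)
    fix q assume "(S ^^ q) ` V = (S ^^ Suc q) ` V"
    then have "descent V S \<le> enat q"
      unfolding descent_def by (intro Inf_lower) blast
    then show False
      using inf by simp
  qed
next
  assume "\<forall>q. (S ^^ q) ` V \<noteq> (S ^^ Suc q) ` V"
  then have empty: "{enat q |q. (S ^^ q) ` V = (S ^^ Suc q) ` V} = {}"
    by blast
  show "descent V S = \<infinity>"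
    unfolding descent_def empty by (simp add: top_enat_def)
qed

text \<open>Reconciles the two sign conventions: the operator spectrum uses \<open>l - T\<close>,
  the algebra spectrum \<open>T - l\<close>.\<close>

lemma range_funpow_uminus:
  fixes A :: "'a::real_vector \<Rightarrow> 'a"
  assumes A: "linear A"
  shows "range ((\<lambda>x. - A x) ^^ n) = range (A ^^ n)"
proof (induction n)
  case (Suc n)
  have "linear (A ^^ n)"
    using A by (induction n) (auto intro: linear_compose linear_id)
  then have neg: "(A ^^ n) (- x) = - (A ^^ n) x" for x
    by (rule linear_neg)
  have "range ((\<lambda>x. - A x) ^^ Suc n) = (\<lambda>x. - A x) ` range (A ^^ n)"
    unfolding Suc[symmetric] by (simp add: image_comp)
  also have "\<dots> = (A \<circ> A ^^ n) ` range uminus"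
    by (simp only: image_comp) (simp add: o_def neg linear_neg[OF A])
  finally show ?case
    by simp
qed simp

lemma left_mult_funpow: "(left_mult A ^^ n) S = A ^^ n \<circ> S"
  by (induction n) (auto simp: left_mult_def)

text \<open>The images are the right ideals generated by \<open>A ^^ q\<close> and
  \<open>A ^^ Suc q\<close>; the first lies in the second exactly when its generator
  \<open>A ^^ q\<close> does.\<close>

lemma left_mult_funpow_image_eq_iff:
  assumes A: "A \<in> bounded_ops"
  shows "(left_mult A ^^ q) ` bounded_ops = (left_mult A ^^ Suc q) ` bounded_ops \<longleftrightarrow>
    (\<exists>R \<in> bounded_ops. A ^^ q = A ^^ Suc q \<circ> R)"
proof
  assume "(left_mult A ^^ q) ` bounded_ops = (left_mult A ^^ Suc q) ` bounded_ops"
  then have "A ^^ q \<circ> id \<in> (left_mult A ^^ Suc q) ` bounded_ops"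
    using id_in_bounded_ops by (metis imageI left_mult_funpow)
  then show "\<exists>R \<in> bounded_ops. A ^^ q = A ^^ Suc q \<circ> R"
    unfolding left_mult_funpow by auto
next
  assume "\<exists>R \<in> bounded_ops. A ^^ q = A ^^ Suc q \<circ> R"
  then obtain R where R: "R \<in> bounded_ops" "A ^^ q = A ^^ Suc q \<circ> R"
    by blast
  show "(left_mult A ^^ q) ` bounded_ops = (left_mult A ^^ Suc q) ` bounded_ops"
  proof (intro subset_antisym image_subsetI)
    fix S :: "'a \<Rightarrow> 'a" assume S: "S \<in> bounded_ops"
    have "A ^^ q \<circ> S = A ^^ Suc q \<circ> (R \<circ> S)"
      using R(2) by (metis comp_assoc)
    then show "(left_mult A ^^ q) S \<in> (left_mult A ^^ Suc q) ` bounded_ops"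
      using compose_in_bounded_ops[OF R(1) S] unfolding left_mult_funpow by blast
    have "A ^^ Suc q \<circ> S = A ^^ q \<circ> (A \<circ> S)"
      by (simp add: funpow_Suc_right comp_assoc del: funpow.simps)
    then show "(left_mult A ^^ Suc q) S \<in> (left_mult A ^^ q) ` bounded_ops"
      using compose_in_bounded_ops[OF A S] unfolding left_mult_funpow by blast
  qed
qed

theorem theorem3:
  fixes T :: "'a::complex_banach \<Rightarrow> 'a"
  assumes "T \<in> bounded_ops"
    and "\<And>G. G \<in> components (su_resolvent T) \<Longrightarrow> G \<inter> point_resolvent T \<noteq> {}"
  shows "desc_spectrum T = desc_spectrum_alg T"
proof -
  \<comment> \<open>The stabilization conditions agree for each \<open>l\<close> and each exponent
    \<open>q\<close> separately.\<close>
  have "range ((\<lambda>x. l *\<^sub>C x - T x) ^^ q) = range ((\<lambda>x. l *\<^sub>C x - T x) ^^ Suc q) \<longleftrightarrow>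
    (left_mult (\<lambda>x. T x - l *\<^sub>C x) ^^ q) ` bounded_ops =
      (left_mult (\<lambda>x. T x - l *\<^sub>C x) ^^ Suc q) ` bounded_ops" for l q
  proof -
    define A where "A = (\<lambda>x. T x - l *\<^sub>C x)"
    have A: "A \<in> bounded_ops"
      unfolding A_def using assms(1) by (rule diff_scaleC_in_bounded_ops)
    have neg: "(\<lambda>x. l *\<^sub>C x - T x) = (\<lambda>x. - A x)"
      by (simp add: A_def)
    \<comment> \<open>\<open>A - \<mu>\<close> is \<open>T - (l + \<mu>)\<close>, so the inclusion
      of resolvents for \<open>T\<close> covers every shift of \<open>A\<close>.\<close>
    have inj: "inj (\<lambda>x. A x - \<mu> *\<^sub>C x)" if "surj (\<lambda>x. A x - \<mu> *\<^sub>C x)" for \<mu>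
      using that su_resolvent_subset_point_resolvent[OF assms]
      unfolding A_def shift_shift by (auto simp flip: mem_su_resolvent mem_point_resolvent)
    have "range (A ^^ q) = range (A ^^ Suc q) \<longleftrightarrow> (\<exists>R \<in> bounded_ops. A ^^ q = A ^^ Suc q \<circ> R)"
    proof
      assume "range (A ^^ q) = range (A ^^ Suc q)"
      then show "\<exists>R \<in> bounded_ops. A ^^ q = A ^^ Suc q \<circ> R"
        by (intro finite_descent_imp_factor[OF A _ inj]) auto
    next
      assume "\<exists>R \<in> bounded_ops. A ^^ q = A ^^ Suc q \<circ> R"
      then obtain R where "A ^^ q = A ^^ Suc q \<circ> R"
        by blast
      then have "range (A ^^ q) \<subseteq> range (A ^^ Suc q)"
        by (metis image_comp image_mono subset_UNIV)
      moreover have "range (A ^^ Suc q) \<subseteq> range (A ^^ q)"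
        unfolding funpow_Suc_right by auto
      ultimately show "range (A ^^ q) = range (A ^^ Suc q)"
        by blast
    qed
    then show ?thesis
      unfolding neg range_funpow_uminus[OF bounded_linear.linear[OF bounded_opsD(1)[OF A]]]
        A_def[symmetric] left_mult_funpow_image_eq_iff[OF A] .
  qed
  then show ?thesis
    by (simp only: desc_spectrum_def desc_spectrum_alg_def descent_eq_infinity_iff)
qed

end
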